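(* There exist infinitely many pairwise non-isomorphic completely inextensible association schemes.
   Context: $\mathbb{N}$ includes $0$. Association scheme: for a finite nonempty set $Q$, a pair $\mathfrak{X}=(Q,\Gamma)$ where $\Gamma=\{C_1,\dots,C_s\}$ is a partition of $Q\times Q$ such that (A1) $C_1=\{(x,x)\mid x\in Q\}$; (A2) for every $C_i\in\Gamma$, $\{(y,x)\mid (x,y)\in C_i\}\in\Gamma$; (A3) for all $C_i,C_j,C_k\in\Gamma$ there is $c(i,j,k)\in\mathbb{N}$ with $|\{z\in Q\mid (x,z)\in C_i,\ (z,y)\in C_j\}|=c(i,j,k)$ for all $(x,y)\in C_k$. Two association schemes $(Q,\Gamma)$ and $(Q',\Gamma')$ are isomorphic if there is a bijection $Q\to Q'$ whose induced bijection $Q\times Q\to Q'\times Q'$ maps the members of $\Gamma$ onto the members of $\Gamma'$. Notation: $\mathrm{pr}:Q^n\to Q^{n-1}$ deletes the last coordinate ($n>1$). For $\bar u=(u_1,\dots,u_n)\in Q^n$ and $\tau\in\mathrm{Symm}_n$ (symmetric group on $n$ elements), $\bar u^\tau:=(u_{\tau(1)},\dots,u_{\tau(n)})$, and $C^\tau:=\{\bar u^\tau\mid \bar u\in C\}$ for $C\subseteq Q^n$. $t$-prescheme (height $t$ presuperscheme) on $Q$, $t\in\mathbb{N}$: a family $\{\Gamma^n\}_{0\le n\le t}$, where $\Gamma^n=\{C^n_1,\dots,C^n_{s_n}\}$ is a partition of $Q^{n+2}$ into nonempty sets, such that (P1) $C^0_1=\{(x,x)\mid x\in Q\}$; (P2)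 for $1\le n\le t$ and $C\in\Gamma^n$, $\mathrm{pr}(C)\in\Gamma^{n-1}$; (P3) for $0\le n\le t$, $C\in\Gamma^n$, $\tau\in\mathrm{Symm}_{n+2}$, $C^\tau\in\Gamma^n$; (P4) for all $m,n\in\mathbb{N}$ with $m+n\le t$ and all $C^m_i\in\Gamma^m$, $C^n_j\in\Gamma^n$, $C^{m+n}_k\in\Gamma^{m+n}$ there is $c(i,j,k;m,n)\in\mathbb{N}$ such that for all $(x_0,\dots,x_m,y_0,\dots,y_n)\in C^{m+n}_k$, $|\{z\in Q\mid (x_0,\dots,x_m,z)\in C^m_i,\ (z,y_0,\dots,y_n)\in C^n_j\}|=c(i,j,k;m,n)$. An association scheme $\mathfrak{X}=(Q,\Gamma)$ is extensible to height $t$ if there is a $t$-prescheme $\{\Gamma^n\}_{0\le n\le t}$ on $Q$ with $\Gamma^0=\Gamma$. It is completely inextensible if it is not extensible to height $t$ for any integer $t\ge 1$. *)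

theory Defs
  imports "HOL-Library.Disjoint_Sets" "HOL-Combinatorics.Permutations"
begin

definition association_scheme :: "'a set \<Rightarrow> 'a rel set \<Rightarrow> bool" where
  "association_scheme Q \<Gamma> \<longleftrightarrow>
     finite Q \<and> Q \<noteq> {} \<and>
     partition_on (Q \<times> Q) \<Gamma> \<and>
     Id_on Q \<in> \<Gamma> \<and>
     (\<forall>C\<in>\<Gamma>. C\<inverse> \<in> \<Gamma>) \<and>
     (\<forall>C\<in>\<Gamma>. \<forall>D\<in>\<Gamma>. \<forall>E\<in>\<Gamma>. \<exists>c::nat. \<forall>(x, y)\<in>E.
        card {z \<in> Q. (x, z) \<in> C \<and> (z, y) \<in> D} = c)"

definition isomorphic_schemes ::
  "'a set \<Rightarrow> 'a rel set \<Rightarrow> 'b set \<Rightarrow> 'b rel set \<Rightarrow> bool" where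
  "isomorphic_schemes Q \<Gamma> Q' \<Gamma>' \<longleftrightarrow>
     (\<exists>f. bij_betw f Q Q' \<and> (\<lambda>C. map_prod f f ` C) ` \<Gamma> = \<Gamma>')"

text \<open>Elements of $Q^n$ are lists of length \<open>n\<close> over \<open>Q\<close>, so deletion of the last
  coordinate is \<^const>\<open>butlast\<close>, and the tuple $u^\tau$ is \<^const>\<open>permute_list\<close> applied
  to \<open>\<tau>\<close> and \<open>u\<close>, with coordinates numbered from \<open>0\<close>.\<close>

definition tuples :: "'a set \<Rightarrow> nat \<Rightarrow> 'a list set" where
  "tuples Q n = {u. set u \<subseteq> Q \<and> length u = n}"

text \<open>A $t$-prescheme is given by a total function \<open>G\<close> of which only the values at
  \<open>n \<le> t\<close> matter. In the last clause \<open>xs\<close> is $(x_0,\dots,x_m)$ and \<open>ys\<close> is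
  $(y_0,\dots,y_n)$.\<close>

definition prescheme :: "nat \<Rightarrow> 'a set \<Rightarrow> (nat \<Rightarrow> 'a list set set) \<Rightarrow> bool" where
  "prescheme t Q G \<longleftrightarrow>
     finite Q \<and> Q \<noteq> {} \<and>
     (\<forall>n\<le>t. partition_on (tuples Q (n + 2)) (G n)) \<and>
     {[x, x] | x. x \<in> Q} \<in> G 0 \<and>
     (\<forall>n. 1 \<le> n \<and> n \<le> t \<longrightarrow> (\<forall>C\<in>G n. butlast ` C \<in> G (n - 1))) \<and>
     (\<forall>n\<le>t. \<forall>C\<in>G n. \<forall>\<tau>. \<tau> permutes {..<n + 2} \<longrightarrow> permute_list \<tau> ` C \<in> G n) \<and>
     (\<forall>m n. m + n \<le> t \<longrightarrow>
        (\<forall>C\<in>G m. \<forall>D\<in>G n. \<forall>E\<in>G (m + n). \<exists>c::nat. \<forall>xs ys.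
           length xs = m + 1 \<and> length ys = n + 1 \<and> xs @ ys \<in> E \<longrightarrow>
           card {z \<in> Q. xs @ [z] \<in> C \<and> z # ys \<in> D} = c))"

definition extensible_to_height :: "nat \<Rightarrow> 'a set \<Rightarrow> 'a rel set \<Rightarrow> bool" where
  "extensible_to_height t Q \<Gamma> \<longleftrightarrow>
     (\<exists>G. prescheme t Q G \<and> G 0 = (\<lambda>C. (\<lambda>(x, y). [x, y]) ` C) ` \<Gamma>)"

definition completely_inextensible :: "'a set \<Rightarrow> 'a rel set \<Rightarrow> bool" where
  "completely_inextensible Q \<Gamma> \<longleftrightarrow> (\<forall>t\<ge>1. \<not> extensible_to_height t Q \<Gamma>)"

end

theory Submission
  imports Defs
begin

text \<open>A prescheme of height at least \<open>1\<close> colours triples, and its axioms force any two pairs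
  \<open>(u, v)\<close> and \<open>(u', v')\<close> of the same class of the scheme to carry the same four-point
  configurations: if points \<open>z, w\<close> stand in prescribed relations to \<open>u\<close>, to \<open>v\<close> and to each
  other, then there are points \<open>z', w'\<close> in the same relations to \<open>u'\<close>, to \<open>v'\<close> and to each
  other (\<open>four_point_transfer\<close>). A scheme that violates this for a single pair of pairs is thus
  completely inextensible.

  Such schemes arise from nets, i.e. from a set of points with coordinate functions any two of
  which can be prescribed independently and then determine the point. The pairs of points are
  classified by the set of coordinates on which they agree; a counting argument
  (\<open>superset_counts_determine_exact_counts\<close>, \<open>agree_counts\<close>) shows that this is always an
  association scheme. In a net with three coordinates let \<open>u, v\<close> agree nowhere, let \<open>z\<close>
  have the first coordinate of \<open>u\<close> and the second of \<open>v\<close>, and let \<open>w\<close> have the first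
  of \<open>v\<close> and the second of \<open>u\<close>. Then \<open>z\<close> and \<open>w\<close> are determined by relations
  of the scheme, so in an extensible scheme the question whether they agree on the third coordinate
  must have the same answer for all such \<open>u, v\<close>.

  For the addition table of the integers modulo \<open>n \<ge> 4\<close>, with row, column and entry as
  coordinates, the answer varies: take \<open>u = (0, 0)\<close>. With \<open>v = (1, 1)\<close> the two other corners
  are \<open>(0, 1)\<close> and \<open>(1, 0)\<close> with equal entries; with \<open>v = (1, 2)\<close> they are
  \<open>(0, 2)\<close> and \<open>(1, 0)\<close> with different entries. The tables have \<open>n * n\<close> points, so
  different \<open>n\<close> give non-isomorphic schemes.\<close>

section \<open>Four-point configurations in extensible schemes\<close>

text \<open>Height \<open>1\<close> is all that is ever used of a prescheme. In the counting axiom the last point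
  \<open>z\<close> of a triple is tied to a third given point \<open>y\<close> by a relation of the scheme; this is
  what links four points.\<close>

lemma prescheme_triples:
  assumes G: "prescheme t Q G" and t: "t \<ge> 1"
  shows "finite Q"
    and "partition_on (tuples Q 2) (G 0)" and "partition_on (tuples Q 3) (G 1)"
    and "\<And>C. C \<in> G 1 \<Longrightarrow> butlast ` C \<in> G 0"
    and "\<And>C \<tau>. C \<in> G 1 \<Longrightarrow> \<tau> permutes {..<3} \<Longrightarrow> permute_list \<tau> ` C \<in> G 1"
    and "\<And>C D E. C \<in> G 1 \<Longrightarrow> D \<in> G 0 \<Longrightarrow> E \<in> G 1 \<Longrightarrow> \<exists>c. \<forall>x0 x1 y. [x0, x1, y] \<in> E \<longrightarrow>
      card {z \<in> Q. [x0, x1, z] \<in> C \<and> [z, y] \<in> D} = c"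
proof -
  note clauses = G[unfolded prescheme_def]
  show "finite Q"
    using clauses by (rule conjunct1)
  note clauses = clauses[THEN conjunct2, THEN conjunct2]
  note part = clauses[THEN conjunct1, rule_format]
  show "partition_on (tuples Q 2) (G 0)" "partition_on (tuples Q 3) (G 1)"
    using part[of 0] part[of 1] t by (simp_all add: numeral_2_eq_2 numeral_3_eq_3)
  note clauses = clauses[THEN conjunct2, THEN conjunct2]
  show "\<And>C. C \<in> G 1 \<Longrightarrow> butlast ` C \<in> G 0"
    using clauses[THEN conjunct1, rule_format, of 1] t by simp
  note clauses = clauses[THEN conjunct2]
  show "\<And>C \<tau>. C \<in> G 1 \<Longrightarrow> \<tau> permutes {..<3} \<Longrightarrow> permute_list \<tau> ` C \<in> G 1"
    using clauses[THEN conjunct1, rule_format, of 1] t by (simp add: numeral_3_eq_3)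
  note counts = clauses[THEN conjunct2, rule_format, of 1 0]
  fix C D E assume "C \<in> G 1" "D \<in> G 0" "E \<in> G 1"
  then obtain c where c: "\<forall>xs ys. length xs = 1 + 1 \<and> length ys = 0 + 1 \<and> xs @ ys \<in> E \<longrightarrow>
      card {z \<in> Q. xs @ [z] \<in> C \<and> z # ys \<in> D} = c"
    using counts[of C D E] t by auto
  have "card {z \<in> Q. [x0, x1, z] \<in> C \<and> [z, y] \<in> D} = c" if "[x0, x1, y] \<in> E" for x0 x1 y
    using c[rule_format, of "[x0, x1]" "[y]"] that by simp
  then show "\<exists>c. \<forall>x0 x1 y. [x0, x1, y] \<in> E \<longrightarrow> card {z \<in> Q. [x0, x1, z] \<in> C \<and> [z, y] \<in> D} = c"
    by blast
qed

text \<open>Within one class of triples, every pair of coordinates stays within one class of pairs,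
  because coordinates can be permuted before the last one is deleted.\<close>

lemma prescheme_triple_pairs:
  assumes G: "prescheme t Q G" and t: "t \<ge> 1" and C: "C \<in> G 1"
    and p: "[x, y, z] \<in> C" and q: "[x', y', z'] \<in> C" and A: "A \<in> G 0"
  shows "[x, y] \<in> A \<Longrightarrow> [x', y'] \<in> A"
    and "[x, z] \<in> A \<Longrightarrow> [x', z'] \<in> A"
    and "[z, y] \<in> A \<Longrightarrow> [z', y'] \<in> A"
proof -
  have pr: "[b, b'] \<in> A \<Longrightarrow> [d, d'] \<in> A"
    if D: "D \<in> G 1" and "[b, b', b''] \<in> D" "[d, d', d''] \<in> D" for D b b' b'' d d' d''
  proof -
    have "butlast ` D \<in> G 0"
      using prescheme_triples(4)[OF G t D] .
    moreover have "[b, b'] \<in> butlast ` D" "[d, d'] \<in> butlast ` D"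
      using that by force+
    moreover have "disjoint (G 0)"
      using prescheme_triples(2)[OF G t] unfolding partition_on_def by blast
    ultimately show "[b, b'] \<in> A \<Longrightarrow> [d, d'] \<in> A"
      using A by (auto dest: disjointD)
  qed
  have perm: "permute_list (transpose i j) ` C \<in> G 1" if "i < 3" "j < 3" for i j
    using that by (intro prescheme_triples(5)[OF G t C] permutes_swap_id) auto
  show "[x, y] \<in> A \<Longrightarrow> [x', y'] \<in> A"
    using pr[OF C p q] .
  have "permute_list (transpose 1 2) [a, b, c] = [a, c, b]" for a b c :: 'a
    by (simp add: permute_list_def transpose_def upt_rec)
  then have m1: "[x, z, y] \<in> permute_list (transpose 1 2) ` C"
    "[x', z', y'] \<in> permute_list (transpose 1 2) ` C"
    using p q by (metis imageI)+
  then show "[x, z] \<in> A \<Longrightarrow> [x', z'] \<in> A"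
    using pr[OF perm m1] by simp
  have "permute_list (transpose 0 2) [a, b, c] = [c, b, a]" for a b c :: 'a
    by (simp add: permute_list_def transpose_def upt_rec)
  then have m0: "[z, y, x] \<in> permute_list (transpose 0 2) ` C"
    "[z', y', x'] \<in> permute_list (transpose 0 2) ` C"
    using p q by (metis imageI)+
  then show "[z, y] \<in> A \<Longrightarrow> [z', y'] \<in> A"
    using pr[OF perm m0] by simp
qed

text \<open>The point \<open>z'\<close> exists because the class of the triple \<open>(u, v, z)\<close> projects onto the
  whole class of \<open>(u, v)\<close>; then \<open>w'\<close> exists because the number of fourth points in a
  prescribed position is the same, hence nonzero, for all triples of that class.\<close>

lemma four_point_transfer:
  assumes ext: "extensible_to_height t Q \<Gamma>" and t: "t \<ge> 1"
    and rels: "E \<in> \<Gamma>" "A \<in> \<Gamma>" "B \<in> \<Gamma>" "C \<in> \<Gamma>" "D \<in> \<Gamma>" "F \<in> \<Gamma>"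
    and uv: "(u, v) \<in> E" and uv': "(u', v') \<in> E"
    and z: "(u, z) \<in> A" "(z, v) \<in> B"
    and w: "(u, w) \<in> C" "(w, v) \<in> D" "(w, z) \<in> F"
  shows "\<exists>z' w'. (u', z') \<in> A \<and> (z', v') \<in> B \<and> (u', w') \<in> C \<and> (w', v') \<in> D \<and> (w', z') \<in> F"
proof -
  obtain G where G: "prescheme t Q G" and G0: "G 0 = (\<lambda>C. (\<lambda>(x, y). [x, y]) ` C) ` \<Gamma>"
    using ext unfolding extensible_to_height_def by blast
  define L where "L R = (\<lambda>(x, y). [x, y]) ` R" for R :: "'a rel"
  have L: "[x, y] \<in> L R \<longleftrightarrow> (x, y) \<in> R" for x y R
    by (auto simp: L_def)
  have LG: "L R \<in> G 0" if "R \<in> \<Gamma>" for R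
    using that G0 by (simp add: L_def)
  note part0 = prescheme_triples(2)[OF G t] and part1 = prescheme_triples(3)[OF G t]
  have inQ: "x \<in> Q \<and> y \<in> Q" if "(x, y) \<in> R" "R \<in> \<Gamma>" for x y R
  proof -
    have "[x, y] \<in> tuples Q 2"
      using part0 LG[OF that(2)] L that(1) unfolding partition_on_def by blast
    then show ?thesis
      by (simp add: tuples_def)
  qed
  have Q: "u \<in> Q" "v \<in> Q" "z \<in> Q" "w \<in> Q"
    using inQ uv z w rels by blast+
  then have "[u, v, z] \<in> tuples Q 3" "[u, v, w] \<in> tuples Q 3"
    by (auto simp: tuples_def)
  then obtain T K where T: "T \<in> G 1" "[u, v, z] \<in> T" and K: "K \<in> G 1" "[u, v, w] \<in> K"
    using part1 unfolding partition_on_def by blast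
  have "butlast ` T \<in> G 0"
    using prescheme_triples(4)[OF G t T(1)] .
  moreover have "[u, v] \<in> butlast ` T"
    using T(2) by force
  moreover have "[u, v] \<in> L E"
    using L uv by blast
  moreover have "disjoint (G 0)"
    using part0 unfolding partition_on_def by blast
  ultimately have "butlast ` T = L E"
    using LG[OF rels(1)] by (auto dest: disjointD)
  then have "[u', v'] \<in> butlast ` T"
    using L uv' by blast
  then obtain l where l: "l \<in> T" "butlast l = [u', v']"
    by auto
  have "l \<in> tuples Q 3"
    using part1 T(1) l(1) unfolding partition_on_def by blast
  then have "l \<noteq> []"
    by (auto simp: tuples_def)
  then have "l = [u', v', last l]"
    using l(2) append_butlast_last_id by fastforce
  then obtain z' where z': "[u', v', z'] \<in> T"
    using l(1) by metis
  obtain c where c: "\<forall>x0 x1 y. [x0, x1, y] \<in> T \<longrightarrow>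
      card {q \<in> Q. [x0, x1, q] \<in> K \<and> [q, y] \<in> L F} = c"
    using prescheme_triples(6)[OF G t K(1) LG[OF rels(6)] T(1)] by blast
  define W where "W x0 x1 y = {q \<in> Q. [x0, x1, q] \<in> K \<and> [q, y] \<in> L F}" for x0 x1 y
  have "card (W u v z) = card (W u' v' z')"
    unfolding W_def using c T(2) z' by presburger
  moreover have "w \<in> W u v z"
    unfolding W_def using Q(4) K(2) L w(3) by blast
  moreover have "finite (W u v z)"
    unfolding W_def using prescheme_triples(1)[OF G t] by simp
  ultimately have "W u' v' z' \<noteq> {}"
    by (metis card_0_eq card.empty emptyE)
  then obtain w' where w': "[u', v', w'] \<in> K" "[w', z'] \<in> L F"
    unfolding W_def by blast
  note pairsT = prescheme_triple_pairs[OF G t T(1) T(2) z']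
    and pairsK = prescheme_triple_pairs[OF G t K(1) K(2) w'(1)]
  have "[u', z'] \<in> L A" "[z', v'] \<in> L B"
    using pairsT(2)[OF LG[OF rels(2)]] pairsT(3)[OF LG[OF rels(3)]] z by (simp_all add: L)
  moreover have "[u', w'] \<in> L C" "[w', v'] \<in> L D"
    using pairsK(2)[OF LG[OF rels(4)]] pairsK(3)[OF LG[OF rels(5)]] w by (simp_all add: L)
  ultimately show ?thesis
    using w'(2) L by blast
qed

section \<open>The association scheme of a net\<close>

text \<open>Inclusion--exclusion in recursive form: the elements with \<open>c z = S\<close> are those with
  \<open>S \<subseteq> c z\<close>, except those whose \<open>c z\<close> is one of the larger sets.\<close>

lemma superset_counts_determine_exact_counts:
  fixes c :: "'a \<Rightarrow> 'i set" and c' :: "'b \<Rightarrow> 'i set"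
  assumes I: "finite I" and fin: "finite A" "finite B"
    and c: "\<And>z. z \<in> A \<Longrightarrow> c z \<subseteq> I" and c': "\<And>z. z \<in> B \<Longrightarrow> c' z \<subseteq> I"
    and sup: "\<And>S. S \<subseteq> I \<Longrightarrow> card {z \<in> A. S \<subseteq> c z} = card {z \<in> B. S \<subseteq> c' z}"
  shows "card {z \<in> A. c z = S} = card {z \<in> B. c' z = S}"
proof (cases "S \<subseteq> I")
  case True
  then show ?thesis
  proof (induction "card (I - S)" arbitrary: S rule: less_induct)
    case less
    let ?U = "{T. S \<subset> T \<and> T \<subseteq> I}"
    have finU: "finite ?U"
      using I by simp
    have split: "card {z \<in> X. S \<subseteq> d z} = card {z \<in> X. d z = S} + (\<Sum>T\<in>?U. card {z \<in> X. d z = T})"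
      if X: "finite X" and d: "\<And>z. z \<in> X \<Longrightarrow> d z \<subseteq> I" for X and d :: "'c \<Rightarrow> 'i set"
    proof -
      have "{z \<in> X. S \<subseteq> d z} = {z \<in> X. d z = S} \<union> (\<Union>T\<in>?U. {z \<in> X. d z = T})"
        using d by auto
      moreover have "card ({z \<in> X. d z = S} \<union> (\<Union>T\<in>?U. {z \<in> X. d z = T})) =
          card {z \<in> X. d z = S} + card (\<Union>T\<in>?U. {z \<in> X. d z = T})"
        using X finU by (intro card_Un_disjoint) auto
      moreover have "card (\<Union>T\<in>?U. {z \<in> X. d z = T}) = (\<Sum>T\<in>?U. card {z \<in> X. d z = T})"
        using X finU by (intro card_UN_disjoint) auto
      ultimately show ?thesis
        by simp
    qed
    have "card {z \<in> A. c z = T} = card {z \<in> B. c' z = T}" if "T \<in> ?U" for T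
    proof (rule less.hyps)
      show "card (I - T) < card (I - S)"
        using that I by (intro psubset_card_mono) auto
    qed (use that in auto)
    then have "(\<Sum>T\<in>?U. card {z \<in> A. c z = T}) = (\<Sum>T\<in>?U. card {z \<in> B. c' z = T})"
      by simp
    then show ?case
      using split[OF fin(1) c] split[OF fin(2) c'] sup[OF less.prems] by simp
  qed
next
  case False
  then have "{z \<in> A. c z = S} = {}" "{z \<in> B. c' z = S} = {}"
    using c c' by auto
  then show ?thesis
    by (simp only: card.empty)
qed

text \<open>The points on which the coordinate \<open>i\<close> has a given value form a line, and the lines
  obtained from one \<open>i\<close> form a parallel class. The axiom \<open>meet\<close> says that two lines of
  different classes have exactly one common point.\<close>

locale net =
  fixes Q :: "'a set" and I :: "'i set" and f :: "'i \<Rightarrow> 'a \<Rightarrow> 'b"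
  assumes finite_points: "finite Q" and nonempty: "Q \<noteq> {}"
    and finite_index: "finite I" and two_coords: "card I \<ge> 2"
    and meet: "\<And>i j x y. i \<in> I \<Longrightarrow> j \<in> I \<Longrightarrow> i \<noteq> j \<Longrightarrow> x \<in> Q \<Longrightarrow> y \<in> Q \<Longrightarrow>
      \<exists>!z. z \<in> Q \<and> f i z = f i x \<and> f j z = f j y"
begin

definition agree :: "'a \<Rightarrow> 'a \<Rightarrow> 'i set" where
  "agree x y = {i \<in> I. f i x = f i y}"

definition agree_rel :: "'i set \<Rightarrow> 'a rel" where
  "agree_rel S = {(x, y) \<in> Q \<times> Q. agree x y = S}"

text \<open>Only nonempty classes are admitted: the values of \<open>agree\<close> that occur are \<open>I\<close> and,
  depending on the net, the empty set and the singletons.\<close>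

definition scheme :: "'a rel set" where
  "scheme = (\<lambda>(x, y). agree_rel (agree x y)) ` (Q \<times> Q)"

lemma agree_sym: "agree x y = agree y x"
  by (auto simp: agree_def)

lemma agree_subset: "agree x y \<subseteq> I"
  by (auto simp: agree_def)

lemma agree_rel_iff: "(x, y) \<in> agree_rel S \<longleftrightarrow> x \<in> Q \<and> y \<in> Q \<and> agree x y = S"
  by (auto simp: agree_rel_def)

lemma agree_rel_in_scheme: "x \<in> Q \<Longrightarrow> y \<in> Q \<Longrightarrow> agree_rel (agree x y) \<in> scheme"
  unfolding scheme_def by force

lemma point_eqI:
  assumes "x \<in> Q" "y \<in> Q" "i \<in> I" "j \<in> I" "i \<noteq> j" "f i x = f i y" "f j x = f j y"
  shows "x = y"
  using meet[of i j y y] assms by metis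

lemma two_agreements:
  assumes "x \<in> Q" "y \<in> Q" "S \<subseteq> I" "card S \<ge> 2"
  shows "S \<subseteq> agree x y \<longleftrightarrow> x = y"
proof
  assume S: "S \<subseteq> agree x y"
  obtain i j where "i \<in> S" "j \<in> S" "i \<noteq> j"
    using assms(4) by (metis One_nat_def card_le_Suc0_iff_eq card.infinite not_less_eq_eq
        numeral_2_eq_2 zero_le)
  then show "x = y"
    using S assms by (intro point_eqI[of x y i j]) (auto simp: agree_def)
next
  assume "x = y"
  then show "S \<subseteq> agree x y"
    using assms by (auto simp: agree_def)
qed

lemma agree_full_iff: "x \<in> Q \<Longrightarrow> y \<in> Q \<Longrightarrow> agree x y = I \<longleftrightarrow> x = y"
  using two_agreements[of x y I] two_coords agree_subset[of x y] by auto

text \<open>Every line of one parallel class meets each line of another parallel class exactly once.\<close>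

lemma line_card:
  assumes "i \<in> I" "j \<in> I" "i \<noteq> j" "x \<in> Q"
  shows "card {z \<in> Q. f i z = f i x} = card (f j ` Q)"
proof (rule bij_betw_same_card)
  show "bij_betw (f j) {z \<in> Q. f i z = f i x} (f j ` Q)"
    unfolding bij_betw_def
  proof
    show "inj_on (f j) {z \<in> Q. f i z = f i x}"
      using assms by (auto intro!: inj_onI point_eqI[of _ _ i j])
    show "f j ` {z \<in> Q. f i z = f i x} = f j ` Q"
    proof (intro equalityI subsetI)
      fix b assume "b \<in> f j ` Q"
      then obtain y where "y \<in> Q" "b = f j y"
        by auto
      moreover obtain z where "z \<in> Q" "f i z = f i x" "f j z = f j y"
        using meet[of i j x y] assms \<open>y \<in> Q\<close> by blast
      ultimately show "b \<in> f j ` {z \<in> Q. f i z = f i x}"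
        by (metis (mono_tags, lifting) imageI mem_Collect_eq)
    qed auto
  qed
qed

lemma line_card_eq:
  assumes "i \<in> I" "x \<in> Q" "x' \<in> Q"
  shows "card {z \<in> Q. f i z = f i x} = card {z \<in> Q. f i z = f i x'}"
proof -
  obtain j where "j \<in> I" "i \<noteq> j"
    using two_coords assms(1) finite_index
    by (metis One_nat_def card_le_Suc0_iff_eq not_less_eq_eq numeral_2_eq_2)
  then show ?thesis
    using line_card assms by metis
qed

text \<open>Agreement on two or more coordinates means equality, so only conditions on at most one
  coordinate remain to be counted; these define a point, a line, the whole net or nothing.\<close>

lemma agree_superset_counts:
  assumes Q: "x \<in> Q" "y \<in> Q" "x' \<in> Q" "y' \<in> Q" and eq: "agree x y = agree x' y'"
    and ST: "S \<subseteq> I" "T \<subseteq> I"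
  shows "card {z \<in> Q. S \<subseteq> agree x z \<and> T \<subseteq> agree z y} =
    card {z \<in> Q. S \<subseteq> agree x' z \<and> T \<subseteq> agree z y'}"
proof -
  consider "card S \<ge> 2" | "card T \<ge> 2" | "card S < 2" "card T < 2"
    by linarith
  then show ?thesis
  proof cases
    case 1
    then have "{z \<in> Q. S \<subseteq> agree a z \<and> T \<subseteq> agree z b} = (if T \<subseteq> agree a b then {a} else {})"
      if "a \<in> Q" for a b
      using that two_agreements[OF that _ ST(1)] by auto
    then show ?thesis
      using Q eq by simp
  next
    case 2
    then have "{z \<in> Q. S \<subseteq> agree a z \<and> T \<subseteq> agree z b} = (if S \<subseteq> agree a b then {b} else {})"
      if "b \<in> Q" for a b
      using that two_agreements[OF _ that ST(2)] by auto
    then show ?thesis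
      using Q eq by simp
  next
    case 3
    have small: "R = {} \<or> (\<exists>i\<in>I. R = {i})" if "R \<subseteq> I" "card R < 2" for R
    proof -
      have "card R = 0 \<or> card R = 1"
        using that by linarith
      then show ?thesis
        using that finite_subset[OF that(1) finite_index]
        by (metis card_0_eq card_1_singletonE insert_subset)
    qed
    have single: "{i} \<subseteq> agree a b \<longleftrightarrow> f i a = f i b" if "i \<in> I" for i a b
      using that by (auto simp: agree_def)
    consider "S = {}" "T = {}" | j where "S = {}" "j \<in> I" "T = {j}"
      | i where "i \<in> I" "S = {i}" "T = {}"
      | i where "i \<in> I" "S = {i}" "T = {i}"
      | i j where "i \<in> I" "j \<in> I" "i \<noteq> j" "S = {i}" "T = {j}"
      using small[OF ST(1) 3(1)] small[OF ST(2) 3(2)] by metis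
    then show ?thesis
    proof cases
      case 1
      then show ?thesis by simp
    next
      case (2 j)
      then show ?thesis
        using line_card_eq[of j y y'] Q by (simp only: single) simp
    next
      case (3 i)
      then show ?thesis
        using line_card_eq[of i x x'] Q by (simp only: single) (simp add: eq_commute)
    next
      case (4 i)
      have "{z \<in> Q. S \<subseteq> agree a z \<and> T \<subseteq> agree z b} =
          (if i \<in> agree a b then {z \<in> Q. f i z = f i a} else {})" for a b
        using 4 by (auto simp: agree_def)
      then show ?thesis
        using line_card_eq[of i x x'] Q eq 4 by simp
    next
      case (5 i j)
      have "card {z \<in> Q. S \<subseteq> agree a z \<and> T \<subseteq> agree z b} = 1" if ab: "a \<in> Q" "b \<in> Q" for a b
      proof -
        obtain z where "z \<in> Q \<and> f i z = f i a \<and> f j z = f j b"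
          "\<And>y. y \<in> Q \<and> f i y = f i a \<and> f j y = f j b \<Longrightarrow> y = z"
          using meet[OF 5(1-3) ab] by metis
        moreover have "S \<subseteq> agree a x \<and> T \<subseteq> agree x b \<longleftrightarrow> f i x = f i a \<and> f j x = f j b" for x
          using single[OF 5(1), of a x] single[OF 5(2), of x b] 5(4,5) by metis
        ultimately have "{z \<in> Q. S \<subseteq> agree a z \<and> T \<subseteq> agree z b} = {z}"
          by blast
        then show ?thesis
          by simp
      qed
      then show ?thesis
        using Q by simp
    qed
  qed
qed

text \<open>The superset conditions on the two sides are made exact one after the other.\<close>

lemma agree_counts:
  assumes Q: "x \<in> Q" "y \<in> Q" "x' \<in> Q" "y' \<in> Q" and eq: "agree x y = agree x' y'"
  shows "card {z \<in> Q. agree x z = S \<and> agree z y = T} =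
    card {z \<in> Q. agree x' z = S \<and> agree z y' = T}"
proof -
  have *: "card {z \<in> {z \<in> Q. U \<subseteq> agree z y}. agree x z = S} =
      card {z \<in> {z \<in> Q. U \<subseteq> agree z y'}. agree x' z = S}" if "U \<subseteq> I" for U
    by (rule superset_counts_determine_exact_counts[OF finite_index])
      (use finite_points agree_subset agree_superset_counts[OF Q eq _ that] in
        \<open>auto simp: conj_ac\<close>)
  have "card {z \<in> {z \<in> Q. agree x z = S}. agree z y = T} =
      card {z \<in> {z \<in> Q. agree x' z = S}. agree z y' = T}"
    by (rule superset_counts_determine_exact_counts[OF finite_index])
      (use finite_points agree_subset * in \<open>auto simp: conj_ac\<close>)
  then show ?thesis
    by (simp add: conj_ac)
qed

theorem association_scheme_scheme: "association_scheme Q scheme"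
  unfolding association_scheme_def
proof (intro conjI)
  show "partition_on (Q \<times> Q) scheme"
  proof (rule partition_onI)
    show "\<Union> scheme = Q \<times> Q"
      by (auto simp: scheme_def agree_rel_iff)
    show "{} \<notin> scheme"
      by (auto simp: scheme_def agree_rel_def)
    show "disjnt p q" if "p \<in> scheme" "q \<in> scheme" "p \<noteq> q" for p q
      using that by (auto simp: scheme_def agree_rel_def disjnt_def)
  qed
  obtain q where q: "q \<in> Q"
    using nonempty by auto
  then have "agree q q = I"
    by (simp add: agree_full_iff)
  moreover have "agree_rel I = Id_on Q"
    by (auto simp: agree_rel_iff agree_full_iff)
  ultimately show "Id_on Q \<in> scheme"
    using agree_rel_in_scheme[OF q q] by simp
  have "(agree_rel S)\<inverse> = agree_rel S" for S
    using agree_sym by (auto simp: agree_rel_iff)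
  then show "\<forall>C\<in>scheme. C\<inverse> \<in> scheme"
    by (auto simp: scheme_def)
  show "\<forall>C\<in>scheme. \<forall>D\<in>scheme. \<forall>E\<in>scheme. \<exists>c::nat. \<forall>(x, y)\<in>E.
      card {z \<in> Q. (x, z) \<in> C \<and> (z, y) \<in> D} = c"
  proof (intro ballI)
    fix C D E assume "C \<in> scheme" "D \<in> scheme" "E \<in> scheme"
    then obtain S T x0 y0 where C: "C = agree_rel S" and D: "D = agree_rel T"
      and E: "E = agree_rel (agree x0 y0)" and Q0: "x0 \<in> Q" "y0 \<in> Q"
      by (auto simp: scheme_def)
    have "card {z \<in> Q. (x, z) \<in> C \<and> (z, y) \<in> D} = card {z \<in> Q. agree x0 z = S \<and> agree z y0 = T}"
      if "(x, y) \<in> E" for x y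
    proof -
      have xy: "x \<in> Q" "y \<in> Q" "agree x y = agree x0 y0"
        using that by (auto simp: E agree_rel_iff)
      then have "{z \<in> Q. (x, z) \<in> C \<and> (z, y) \<in> D} = {z \<in> Q. agree x z = S \<and> agree z y = T}"
        by (auto simp: C D agree_rel_iff)
      then show ?thesis
        using agree_counts[OF xy(1,2) Q0 xy(3)] by simp
    qed
    then show "\<exists>c::nat. \<forall>(x, y)\<in>E. card {z \<in> Q. (x, z) \<in> C \<and> (z, y) \<in> D} = c"
      by blast
  qed
qed (use finite_points nonempty in auto)

text \<open>The points \<open>z, w\<close> complete \<open>u, v\<close> to a rectangle with sides along the coordinates
  \<open>i\<close> and \<open>j\<close>. Transferring a rectangle whose diagonal \<open>z, w\<close> lies on a line of class
  \<open>k\<close> must produce the rectangle spanned by \<open>u'\<close> and \<open>v'\<close>, since two coordinates determine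
  a point.\<close>

lemma completely_inextensible_scheme:
  assumes ijk: "i \<in> I" "j \<in> I" "k \<in> I" "i \<noteq> j"
    and Q: "u \<in> Q" "v \<in> Q" "z \<in> Q" "w \<in> Q" "u' \<in> Q" "v' \<in> Q" "z' \<in> Q" "w' \<in> Q"
    and uv: "agree u v = agree u' v'"
    and z: "f i z = f i u" "f j z = f j v" and w: "f i w = f i v" "f j w = f j u"
    and z': "f i z' = f i u'" "f j z' = f j v'" and w': "f i w' = f i v'" "f j w' = f j u'"
    and diag: "f k z = f k w" and no_diag: "f k z' \<noteq> f k w'"
  shows "completely_inextensible Q scheme"
  unfolding completely_inextensible_def
proof (intro allI impI notI)
  fix t :: nat assume t: "t \<ge> 1" and ext: "extensible_to_height t Q scheme"
  have "\<exists>z'' w''. (u', z'') \<in> agree_rel (agree u z) \<and> (z'', v') \<in> agree_rel (agree z v) \<and>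
      (u', w'') \<in> agree_rel (agree u w) \<and> (w'', v') \<in> agree_rel (agree w v) \<and>
      (w'', z'') \<in> agree_rel (agree w z)"
    by (rule four_point_transfer[OF ext t agree_rel_in_scheme[OF Q(1,2)]])
      (use Q uv agree_rel_in_scheme in \<open>auto simp: agree_rel_iff\<close>)
  then obtain z'' w'' where Q'': "z'' \<in> Q" "w'' \<in> Q"
    and eqs: "agree u' z'' = agree u z" "agree z'' v' = agree z v"
      "agree u' w'' = agree u w" "agree w'' v' = agree w v" "agree w'' z'' = agree w z"
    by (auto simp: agree_rel_iff)
  have "i \<in> agree u z" "j \<in> agree z v" "j \<in> agree u w" "i \<in> agree w v" "k \<in> agree w z"
    using ijk z w diag by (auto simp: agree_def)
  then have "i \<in> agree u' z''" "j \<in> agree z'' v'" "j \<in> agree u' w''" "i \<in> agree w'' v'"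
    and k: "k \<in> agree w'' z''"
    using eqs by simp_all
  then have "z'' = z'" "w'' = w'"
    using Q Q'' ijk z' w' by (auto simp: agree_def intro!: point_eqI[of _ _ i j])
  then show False
    using k no_diag by (simp add: agree_def)
qed

end

section \<open>Addition tables of cyclic groups\<close>

text \<open>The cell in row \<open>a\<close> and column \<open>b\<close> of the table is the number \<open>a * n + b\<close>;
  the coordinates \<open>0\<close>, \<open>1\<close>, \<open>2\<close> of a cell are its row, column and entry.\<close>

definition table_coord :: "nat \<Rightarrow> nat \<Rightarrow> nat \<Rightarrow> nat" where
  "table_coord n i x =
    (if i = 0 then x div n else if i = 1 then x mod n else (x div n + x mod n) mod n)"

abbreviation cells :: "nat \<Rightarrow> nat set" where
  "cells n \<equiv> {..<n * n}"

lemma cell_coord: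
  assumes "a < n" "b < n"
  shows "a * n + b \<in> cells n" "table_coord n 0 (a * n + b) = a" "table_coord n 1 (a * n + b) = b"
    "table_coord n 2 (a * n + b) = (a + b) mod n"
proof -
  have "a * n + b < Suc a * n"
    using assms by simp
  also have "\<dots> \<le> n * n"
    using assms by (intro mult_le_mono1) simp
  finally show "a * n + b \<in> cells n"
    by simp
qed (use assms in \<open>auto simp: table_coord_def\<close>)

lemma cellE:
  assumes "x \<in> cells n"
  obtains a b where "a < n" "b < n" "x = a * n + b"
proof
  show "x div n < n" "x mod n < n" "x = x div n * n + x mod n"
    using assms by (auto simp: less_mult_imp_div_less intro!: mod_less_divisor gr0I)
qed

text \<open>The rows of an addition table are permutations.\<close>

lemma ex1_add_mod:
  fixes a s n :: nat
  assumes "a < n" "s < n"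
  shows "\<exists>!b. b < n \<and> (a + b) mod n = s"
proof
  show "(s + n - a) mod n < n \<and> (a + (s + n - a) mod n) mod n = s"
    using assms by (simp add: mod_add_right_eq)
  fix b assume b: "b < n \<and> (a + b) mod n = s"
  have "(s + n - a) mod n = b"
  proof (cases "a + b < n")
    case True
    then show ?thesis using b assms by auto
  next
    case False
    then have "(a + b) mod n = a + b - n"
      using conjunct1[OF b] assms by (simp add: le_mod_geq)
    then show ?thesis using b assms False by simp
  qed
  then show "b = (s + n - a) mod n" ..
qed

lemma table_meet:
  assumes ij: "i < 3" "j < 3" "i \<noteq> j" and "p < n" "q < n"
  shows "\<exists>!z. z \<in> cells n \<and> table_coord n i z = p \<and> table_coord n j z = q"
proof -
  have *: "\<exists>!z. z \<in> cells n \<and> table_coord n i z = p \<and> table_coord n j z = q"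
    if "i < j" "j < 3" "p < n" "q < n" for i j p q
  proof -
    have "\<exists>a<n. \<exists>b<n. \<forall>a'<n. \<forall>b'<n.
        table_coord n i (a' * n + b') = p \<and> table_coord n j (a' * n + b') = q \<longleftrightarrow> a' = a \<and> b' = b"
    proof -
      consider "i = 0" "j = 1" | "i = 0" "j = 2" | "i = 1" "j = 2"
        using \<open>i < j\<close> \<open>j < 3\<close> by linarith
      then show ?thesis
      proof cases
        case 1
        have "table_coord n i (a' * n + b') = p \<and> table_coord n j (a' * n + b') = q \<longleftrightarrow>
            a' = p \<and> b' = q" if "a' < n" "b' < n" for a' b'
          using cell_coord[OF that] 1 by metis
        then show ?thesis
          using \<open>p < n\<close> \<open>q < n\<close> by blast
      next
        case 2
        obtain b where b: "b < n" "\<And>b'. b' < n \<Longrightarrow> (p + b') mod n = q \<longleftrightarrow> b' = b"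
          using ex1_add_mod[OF \<open>p < n\<close> \<open>q < n\<close>] by metis
        have "table_coord n i (a' * n + b') = p \<and> table_coord n j (a' * n + b') = q \<longleftrightarrow>
            a' = p \<and> b' = b" if "a' < n" "b' < n" for a' b'
          using b(2)[OF \<open>b' < n\<close>] cell_coord[OF that] 2 by metis
        then show ?thesis
          using \<open>p < n\<close> b(1) by blast
      next
        case 3
        obtain a where a: "a < n" "\<And>a'. a' < n \<Longrightarrow> (p + a') mod n = q \<longleftrightarrow> a' = a"
          using ex1_add_mod[OF \<open>p < n\<close> \<open>q < n\<close>] by metis
        have "table_coord n i (a' * n + b') = p \<and> table_coord n j (a' * n + b') = q \<longleftrightarrow>
            a' = a \<and> b' = p" if "a' < n" "b' < n" for a' b'
          using a(2)[OF \<open>a' < n\<close>] cell_coord[OF that] 3 by (metis add.commute)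
        then show ?thesis
          using \<open>p < n\<close> a(1) by blast
      qed
    qed
    then obtain a b where ab: "a < n" "b < n"
      and uniq: "\<And>a' b'. a' < n \<Longrightarrow> b' < n \<Longrightarrow>
        table_coord n i (a' * n + b') = p \<and> table_coord n j (a' * n + b') = q \<longleftrightarrow> a' = a \<and> b' = b"
      by metis
    show ?thesis
    proof (rule ex1I[of _ "a * n + b"])
      show "z = a * n + b" if z: "z \<in> cells n \<and> table_coord n i z = p \<and> table_coord n j z = q" for z
      proof -
        obtain a' b' where "a' < n" "b' < n" "z = a' * n + b'"
          using z cellE by blast
        then show ?thesis
          using uniq z by metis
      qed
    qed (use ab uniq[OF ab] cell_coord(1)[OF ab] in blast)
  qed
  show ?thesis
  proof (cases "i < j")
    case True
    then show ?thesis using *[of i j p q] assms by simp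
  next
    case False
    then show ?thesis using *[of j i q p] assms by (simp add: conj_ac)
  qed
qed

lemma table_coord_less:
  assumes "x \<in> cells n"
  shows "table_coord n i x < n"
  using assms by (elim cellE) (auto simp: table_coord_def)

lemma table_net:
  assumes "n \<ge> 1"
  shows "net (cells n) {..<3} (table_coord n)"
proof
  show "cells n \<noteq> {}"
    using assms by (auto simp: lessThan_empty_iff)
  show "\<exists>!z. z \<in> cells n \<and> table_coord n i z = table_coord n i x \<and>
      table_coord n j z = table_coord n j y"
    if "i \<in> {..<3}" "j \<in> {..<3}" "i \<noteq> j" "x \<in> cells n" "y \<in> cells n" for i j x y
    using that by (intro table_meet table_coord_less) auto
qed auto

text \<open>Coordinates are taken modulo \<open>n\<close>, so \<open>n \<ge> 4\<close> is what keeps \<open>(0, 0)\<close> and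
  \<open>(1, 2)\<close> from having the same entry.\<close>

lemma table_completely_inextensible:
  assumes n: "n \<ge> 4"
  shows "completely_inextensible (cells n) (net.scheme (cells n) {..<3} (table_coord n))"
proof -
  interpret net "cells n" "{..<3}" "table_coord n"
    using table_net n by simp
  have three: "{..<3} = {0, 1, 2::nat}"
    by auto
  have two: "2 < n * n" "table_coord n 0 2 = 0" "table_coord n (Suc 0) 2 = 2" "table_coord n 2 2 = 2"
    using n mult_le_mono[OF n n] by (auto simp: table_coord_def)
  note coords = two cell_coord[of 0 n 0, simplified] cell_coord[of 1 n 1, simplified]
    cell_coord[of 0 n 1, simplified] cell_coord[of 1 n 0, simplified]
    cell_coord[of 1 n 2, simplified]
  have "\<forall>i\<in>{0, 1, 2}. table_coord n i 0 \<noteq> table_coord n i (n + 1)"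
    "\<forall>i\<in>{0, 1, 2}. table_coord n i 0 \<noteq> table_coord n i (n + 2)"
    using n by (simp_all add: coords)
  then have "agree 0 (n + 1) = {}" "agree 0 (n + 2) = {}"
    unfolding agree_def three[symmetric] by blast+
  then show ?thesis
    using n by (intro completely_inextensible_scheme[of 0 1 2 0 "n + 1" 1 n 0 "n + 2" 2 n])
      (simp_all add: coords)
qed

theorem corollary4p5:
  shows "\<exists>S :: (nat set \<times> nat rel set) set. infinite S \<and>
    (\<forall>(Q, \<Gamma>)\<in>S. association_scheme Q \<Gamma> \<and> completely_inextensible Q \<Gamma>) \<and>
    pairwise (\<lambda>(Q, \<Gamma>) (Q', \<Gamma>'). \<not> isomorphic_schemes Q \<Gamma> Q' \<Gamma>') S"
proof -
  define X where "X n = (cells n, net.scheme (cells n) {..<3} (table_coord n))" for n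
  have eq: "m = n" if "card (cells m) = card (cells n)" for m n
    using that by (simp add: power2_eq_square[symmetric])
  have "inj_on X {4..}"
    by (rule inj_onI) (metis X_def eq prod.inject)
  then have "infinite (X ` {4..})"
    using finite_imageD infinite_Ici by blast
  moreover have "\<forall>(Q, \<Gamma>)\<in>X ` {4..}. association_scheme Q \<Gamma> \<and> completely_inextensible Q \<Gamma>"
    using net.association_scheme_scheme[OF table_net] table_completely_inextensible
    by (auto simp: X_def)
  moreover have "pairwise (\<lambda>(Q, \<Gamma>) (Q', \<Gamma>'). \<not> isomorphic_schemes Q \<Gamma> Q' \<Gamma>') (X ` {4..})"
  proof (rule pairwiseI, elim imageE)
    fix p q m n assume "p = X m" "q = X n" "p \<noteq> q"
    moreover have "\<not> isomorphic_schemes (cells m) \<Gamma> (cells n) \<Gamma>'" if "m \<noteq> n" for \<Gamma> \<Gamma>'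
      using that eq bij_betw_same_card unfolding isomorphic_schemes_def by blast
    ultimately show "(\<lambda>(Q, \<Gamma>) (Q', \<Gamma>'). \<not> isomorphic_schemes Q \<Gamma> Q' \<Gamma>') p q"
      by (auto simp: X_def)
  qed
  ultimately show ?thesis
    by blast
qed

end
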